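(* Let $q$ be a power of $2$. Then for each positive integer $m$, there is an $\mathbb{F}_q$-subspace $\mathcal{M}$ of $M_{4m}(\mathbb{F}_q)$ of dimension $4m$ in which the elements of determinant zero form a subspace of dimension $m$, and the non-zero elements of this subspace of dimension $m$ have rank $2m$ and are nilpotent.
   Context: $M_n(\mathbb{F}_q)$ is the $\mathbb{F}_q$-vector space of $n\times n$ matrices over $\mathbb{F}_q$. *)

theory Defs
  imports "Jordan_Normal_Form.DL_Rank" "HOL-Library.Cardinality"
begin

abbreviation mat_space :: "nat \<Rightarrow> ('a::field, 'a mat) module" where
  "mat_space n \<equiv> module_mat TYPE('a) n n"

lemma vectorspace_mat_space: "vectorspace class_ring (mat_space n :: ('a::field, 'a mat) module)"
proof -
  interpret abelian_group "mat_space n :: ('a, 'a mat) module"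
    by (rule abelian_group_mat)
  have "Module.module class_ring (mat_space n :: ('a, 'a mat) module)"
    by unfold_locales
      (auto simp: module_mat_simps add_smult_distrib_left_mat add_smult_distrib_right_mat field_simps)
  then show ?thesis
    by (intro vectorspace.intro class_field)
qed

text \<open>\<open>vectorspace.dim\<close> is a \<open>LEAST\<close> and hence meaningful only for finite-dimensional spaces;
  over a finite field this covers every subspace of \<open>mat_space n\<close>.\<close>

definition is_subspace_of_dim :: "nat \<Rightarrow> nat \<Rightarrow> 'a::field mat set \<Rightarrow> bool" where
  "is_subspace_of_dim n d W \<longleftrightarrow>
     VectorSpace.subspace class_ring W (mat_space n) \<and>
     vectorspace.dim class_ring (mat_space n \<lparr>carrier := W\<rparr>) = d"

definition nilpotent_mat :: "nat \<Rightarrow> 'a::field mat \<Rightarrow> bool" where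
  "nilpotent_mat n A \<longleftrightarrow> (\<exists>k. A ^\<^sub>m k = 0\<^sub>m n n)"

end

theory Submission
  imports Defs "HOL-Algebra.Algebraic_Closure_Type" "HOL-Number_Theory.Residues"
begin

text \<open>Let \<open>L \<subset> E\<close> be the fields with \<open>q\<^sup>m\<close> and \<open>q\<^sup>2\<^sup>m\<close> elements and let \<open>y \<in> E - L\<close>. The \<open>2 \<times> 2\<close> matrices
  over \<open>E\<close> with rows \<open>(x, c y + d)\<close> and \<open>(c, x\<^bsup>q^m\<^esup>)\<close>, where \<open>x \<in> E\<close> and \<open>c, d \<in> L\<close>, act on \<open>E\<^sup>2\<close>, a space
  of dimension \<open>4m\<close> over \<open>F\<^sub>q\<close>. The determinant over \<open>E\<close> is \<open>N(x) - c d - c\<^sup>2 y\<close> with \<open>N(x) \<in> L\<close>, so it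
  vanishes only if \<open>x = c = 0\<close>; the remaining matrices have the single entry \<open>d\<close> above the diagonal.
  All dimensions over \<open>F\<^sub>q\<close> are determined by counting elements.\<close>

hide_const (open) Divisibility.prime

section \<open>Vector spaces over finite fields\<close>

lemma (in vectorspace) ex_finite_basis:
  assumes "finite (carrier V)"
  obtains B where "finite B" "basis B" "card B = dim"
proof -
  have "fin_dim"
    unfolding fin_dim_def using assms in_own_span[of "carrier V"] span_is_subset2[of "carrier V"]
    by (intro exI[of _ "carrier V"]) auto
  then obtain B where "finite B" "basis B"
    using finite_basis_exists by blast
  with that show thesis
    using dim_basis by simp
qed

text \<open>Relative to a finite basis, coefficient functions correspond bijectively to vectors;
  taking them extensional on \<open>B\<close> makes the count exact.\<close>

lemma (in vectorspace) card_carrier_eq_power_dim: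
  assumes "finite (carrier V)"
  shows "card (carrier V) = card (carrier K) ^ dim"
proof -
  obtain B where B: "finite B" "basis B" "card B = dim"
    using ex_finite_basis[OF assms] .
  have BV: "B \<subseteq> carrier V"
    using B(2) by (simp add: basis_def)
  have ex1: "\<exists>!a. a \<in> B \<rightarrow>\<^sub>E carrier K \<and> lincomb a B = v" if "v \<in> carrier V" for v
    using basis_criterion[OF B(1) BV] B(2) that by blast
  have closed: "lincomb a B \<in> carrier V" if "a \<in> B \<rightarrow>\<^sub>E carrier K" for a
    using lincomb_closed[OF BV] that by auto
  have "bij_betw (\<lambda>a. lincomb a B) (B \<rightarrow>\<^sub>E carrier K) (carrier V)"
    unfolding bij_betw_def inj_on_def using ex1 closed by (auto simp: image_def) metis+
  then have "card (carrier V) = card (B \<rightarrow>\<^sub>E carrier K)"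
    by (simp add: bij_betw_same_card)
  also have "\<dots> = card (carrier K) ^ dim"
    using B by (simp add: card_PiE)
  finally show ?thesis .
qed

text \<open>A field has at least two elements, so the cardinality determines the exponent. Every
  dimension and rank below is obtained in this way.\<close>

lemma (in vectorspace) dim_eqI_card:
  assumes "finite (carrier K)" "finite (carrier V)" "card (carrier V) = card (carrier K) ^ d"
  shows "dim = d"
proof -
  have "{\<zero>\<^bsub>K\<^esub>, \<one>\<^bsub>K\<^esub>} \<subseteq> carrier K"
    by simp
  then have "card {\<zero>\<^bsub>K\<^esub>, \<one>\<^bsub>K\<^esub>} \<le> card (carrier K)"
    using assms(1) by (intro card_mono)
  then have "1 < card (carrier K)"
    by simp
  then show ?thesis
    using assms(3) card_carrier_eq_power_dim[OF assms(2)] power_inject_exp by metis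
qed

text \<open>Allows operators on an abstract space, later E^2 over F_q, to be carried over to
  matrices acting on \<open>carrier_vec d\<close>.\<close>

lemma vectorspace_coordinates:
  fixes V :: "('a::{field,finite}, 'b, 'c) module_scheme"
  assumes "vectorspace class_ring V" "finite (carrier V)"
    and d: "card (carrier V) = CARD('a) ^ d"
  obtains f where "bij_betw f (carrier_vec d) (carrier V)"
    "\<And>v w. v \<in> carrier_vec d \<Longrightarrow> w \<in> carrier_vec d \<Longrightarrow> f (v + w) = f v \<oplus>\<^bsub>V\<^esub> f w"
    "\<And>c v. v \<in> carrier_vec d \<Longrightarrow> f (c \<cdot>\<^sub>v v) = c \<odot>\<^bsub>V\<^esub> f v"
proof -
  interpret vectorspace class_ring V by fact
  obtain B where B: "finite B" "basis B" "card B = dim"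
    using ex_finite_basis[OF assms(2)] .
  have BV: "B \<subseteq> carrier V"
    using B(2) by (simp add: basis_def)
  have ex1: "\<exists>!a. a \<in> B \<rightarrow>\<^sub>E UNIV \<and> lincomb a B = v" if "v \<in> carrier V" for v
    using basis_criterion[OF B(1) BV] B(2) that by (simp add: class_ring_simps)
  have "card B = d"
    using dim_eqI_card[OF _ assms(2)] d B(3) by (simp add: class_ring_simps)
  then obtain h where h: "bij_betw h B {..<d}"
    using B(1) by (metis card_lessThan finite_lessThan finite_same_card_bij)
  define f where "f v = lincomb (\<lambda>b. v $ h b) B" for v :: "'a vec"
  have hd: "h b < d" if "b \<in> B" for b
    using bij_betwE[OF h] that by auto
  \<comment> \<open>\<open>basis_criterion\<close> gives uniqueness among extensional coefficient
    functions, hence the restriction to \<open>B\<close>.\<close>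
  have f_restrict: "f v = lincomb (restrict (\<lambda>b. v $ h b) B) B" for v
    unfolding f_def using BV by (intro lincomb_cong) (auto simp: class_ring_simps)
  have inj: "v = w" if "v \<in> carrier_vec d" "w \<in> carrier_vec d" "f v = f w" for v w
  proof -
    have "f v \<in> carrier V"
      unfolding f_def using BV by (intro lincomb_closed) (auto simp: class_ring_simps)
    then have "restrict (\<lambda>b. v $ h b) B = restrict (\<lambda>b. w $ h b) B"
      using ex1[of "f v"] that(3) f_restrict[of v] f_restrict[of w] by (metis UNIV_I restrict_PiE_iff)
    then have "v $ h b = w $ h b" if "b \<in> B" for b
      using that by (metis restrict_apply')
    then have "v $ i = w $ i" if "i < d" for i
      using h that unfolding bij_betw_def by (metis imageE lessThan_iff)
    with that show ?thesis
      by (intro eq_vecI) auto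
  qed
  have surj: "\<exists>v\<in>carrier_vec d. f v = u" if "u \<in> carrier V" for u
  proof -
    obtain a where a: "lincomb a B = u"
      using ex1[OF \<open>u \<in> carrier V\<close>] by blast
    \<comment> \<open>Index \<open>h b\<close> receives the coefficient of the basis vector
      \<open>b\<close>.\<close>
    have "f (vec d (\<lambda>i. a (inv_into B h i))) = lincomb a B"
      unfolding f_def using BV hd h
      by (intro lincomb_cong) (auto simp: class_ring_simps bij_betw_inv_into_left)
    with a show ?thesis by auto
  qed
  have "f v \<in> carrier V" for v
    unfolding f_def using BV by (intro lincomb_closed) (auto simp: class_ring_simps)
  then have "bij_betw f (carrier_vec d) (carrier V)"
    unfolding bij_betw_def inj_on_def using inj surj by (auto simp: image_iff) metis
  moreover have "f (v + w) = f v \<oplus>\<^bsub>V\<^esub> f w" if "v \<in> carrier_vec d" "w \<in> carrier_vec d" for v w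
  proof -
    have "f (v + w) = lincomb (\<lambda>b. v $ h b \<oplus>\<^bsub>class_ring\<^esub> w $ h b) B"
      unfolding f_def using BV hd that by (intro lincomb_cong) (auto simp: class_ring_simps)
    also have "\<dots> = f v \<oplus>\<^bsub>V\<^esub> f w"
      unfolding f_def using BV B(1) by (intro lincomb_sum) (auto simp: class_ring_simps)
    finally show ?thesis .
  qed
  moreover have "f (c \<cdot>\<^sub>v v) = c \<odot>\<^bsub>V\<^esub> f v" if "v \<in> carrier_vec d" for c v
  proof -
    have "f (c \<cdot>\<^sub>v v) = lincomb (\<lambda>b. c \<otimes>\<^bsub>class_ring\<^esub> v $ h b) B"
      unfolding f_def using BV hd that by (intro lincomb_cong) (auto simp: class_ring_simps)
    also have "\<dots> = c \<odot>\<^bsub>V\<^esub> f v"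
      unfolding f_def using BV by (intro lincomb_smult) (auto simp: class_ring_simps)
    finally show ?thesis .
  qed
  ultimately show thesis
    using that by blast
qed

section \<open>Subspaces of matrices, rank, and matrices of linear maps\<close>

lemma finite_carrier_vec: "finite (carrier_vec n :: 'a::finite vec set)"
proof -
  have "carrier_vec n \<subseteq> (vec n :: _ \<Rightarrow> 'a vec) ` ({..<n} \<rightarrow>\<^sub>E UNIV)"
  proof
    fix v :: "'a vec" assume "v \<in> carrier_vec n"
    then have "v = vec n (restrict (($) v) {..<n})"
      by (intro eq_vecI) auto
    then show "v \<in> vec n ` ({..<n} \<rightarrow>\<^sub>E UNIV)"
      by (intro image_eqI[where x = "restrict (($) v) {..<n}"]) auto
  qed
  then show ?thesis
    by (rule finite_subset) (simp add: finite_PiE)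
qed

lemma finite_carrier_mat: "finite (carrier_mat m n :: 'a::finite mat set)"
proof -
  have "carrier_mat m n \<subseteq> (mat m n :: _ \<Rightarrow> 'a mat) ` ({..<m} \<times> {..<n} \<rightarrow>\<^sub>E UNIV)"
  proof
    fix A :: "'a mat" assume "A \<in> carrier_mat m n"
    then have "A = mat m n (restrict (($$) A) ({..<m} \<times> {..<n}))"
      by (intro eq_matI) auto
    then show "A \<in> mat m n ` ({..<m} \<times> {..<n} \<rightarrow>\<^sub>E UNIV)"
      by (intro image_eqI[where x = "restrict (($$) A) ({..<m} \<times> {..<n})"]) auto
  qed
  then show ?thesis
    by (rule finite_subset) (simp add: finite_PiE)
qed

lemma is_subspace_of_dimI:
  fixes W :: "'a::{field,finite} mat set"
  assumes "W \<subseteq> carrier_mat n n" "0\<^sub>m n n \<in> W"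
    and "\<And>A B. A \<in> W \<Longrightarrow> B \<in> W \<Longrightarrow> A + B \<in> W"
    and "\<And>c A. A \<in> W \<Longrightarrow> c \<cdot>\<^sub>m A \<in> W"
    and "card W = CARD('a) ^ d"
  shows "is_subspace_of_dim n d W"
proof -
  interpret V: vectorspace class_ring "mat_space n :: ('a, 'a mat) module"
    by (rule vectorspace_mat_space)
  have sub: "VectorSpace.subspace class_ring W (mat_space n)"
    using assms(1-4)
    by (intro subspace.intro submodule.intro V.vectorspace_axioms V.module_axioms)
      (auto simp: module_mat_simps class_ring_simps)
  interpret W: vectorspace class_ring "(mat_space n :: ('a, 'a mat) module)\<lparr>carrier := W\<rparr>"
    by (rule V.subspace_is_vs[OF sub])
  have "finite W"
    using assms(1) finite_carrier_mat finite_subset by blast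
  then have "W.dim = d"
    using assms(5) by (intro W.dim_eqI_card) (auto simp: class_ring_simps)
  with sub show ?thesis
    by (simp add: is_subspace_of_dim_def)
qed

text \<open>The rank is the dimension of the column span, which is the image of the map, so counting
  the image suffices.\<close>

lemma rank_eqI_card:
  fixes A :: "'a::{field,finite} mat"
  assumes A: "A \<in> carrier_mat n n"
    and "card ((\<lambda>v. A *\<^sub>v v) ` carrier_vec n) = CARD('a) ^ d"
  shows "vec_space.rank n A = d"
proof -
  interpret vec_space "TYPE('a)" n .
  have cols: "set (cols A) \<subseteq> carrier_vec n"
    using A cols_dim by blast
  have eq: "span (set (cols A)) = (\<lambda>v. A *\<^sub>v v) ` carrier_vec n"
    using col_space_eq[OF A] A unfolding col_space_def by auto
  interpret W: vectorspace class_ring "span_vs (set (cols A))"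
    using cols by (intro subspace_is_vs span_is_subspace)
  have "W.dim = d"
    using assms(2) finite_carrier_vec
    by (intro W.dim_eqI_card) (auto simp: class_ring_simps eq)
  then show ?thesis
    by (simp add: rank_def)
qed

text \<open>Take the images of the unit vectors as columns; agreement on all vectors then follows by
  building up a vector one coordinate at a time.\<close>

lemma mat_of_linear_map:
  fixes T :: "'a::field vec \<Rightarrow> 'a vec"
  assumes closed: "\<And>v. v \<in> carrier_vec n \<Longrightarrow> T v \<in> carrier_vec n"
    and add: "\<And>v w. v \<in> carrier_vec n \<Longrightarrow> w \<in> carrier_vec n \<Longrightarrow> T (v + w) = T v + T w"
    and smult: "\<And>c v. v \<in> carrier_vec n \<Longrightarrow> T (c \<cdot>\<^sub>v v) = c \<cdot>\<^sub>v T v"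
  obtains A where "A \<in> carrier_mat n n" "\<And>v. v \<in> carrier_vec n \<Longrightarrow> A *\<^sub>v v = T v"
proof -
  define A where "A = mat_of_cols n (map (\<lambda>j. T (unit_vec n j)) [0..<n])"
  have A: "A \<in> carrier_mat n n"
    by (simp add: A_def mat_of_cols_def)
  have A_unit: "A *\<^sub>v unit_vec n j = T (unit_vec n j)" if "j < n" for j
  proof -
    have "A *\<^sub>v unit_vec n j = col A j"
      using A that by (intro eq_vecI) auto
    also have "\<dots> = T (unit_vec n j)"
      unfolding A_def using that closed by (subst col_mat_of_cols) auto
    finally show ?thesis .
  qed
  have "A *\<^sub>v v = T v" if v: "v \<in> carrier_vec n" for v
  proof -
    define p where "p k = vec n (\<lambda>i. if i < k then v $ i else 0)" for k
    have p: "p k \<in> carrier_vec n" for k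
      by (simp add: p_def)
    have "A *\<^sub>v p k = T (p k)" if "k \<le> n" for k
      using that
    proof (induction k)
      case 0
      \<comment> \<open>\<open>p 0\<close> is the zero vector; writing it as 0 times itself lets
        homogeneity show that both sides are zero.\<close>
      have "p 0 = 0 \<cdot>\<^sub>v p 0"
        by (intro eq_vecI) (auto simp: p_def)
      then have "A *\<^sub>v p 0 = 0 \<cdot>\<^sub>v (A *\<^sub>v p 0)" "T (p 0) = 0 \<cdot>\<^sub>v T (p 0)"
        using mult_mat_vec[OF A p, of 0 0] smult[OF p, of 0 0] by simp_all
      moreover have "0 \<cdot>\<^sub>v (A *\<^sub>v p 0) = 0 \<cdot>\<^sub>v T (p 0)"
        using A closed[OF p, of 0] by (intro eq_vecI) auto
      ultimately show ?case
        by simp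
    next
      case (Suc k)
      have "p (Suc k) = p k + v $ k \<cdot>\<^sub>v unit_vec n k"
        using Suc.prems by (intro eq_vecI) (auto simp: p_def less_Suc_eq)
      with Suc show ?case
        using A p A_unit[of k]
        by (simp add: add smult mult_add_distrib_mat_vec[OF A] mult_mat_vec[OF A])
    qed
    moreover have "p n = v"
      using v by (intro eq_vecI) (auto simp: p_def)
    ultimately show ?thesis
      by force
  qed
  with A that show thesis by blast
qed

section \<open>Finite fields inside an algebraic closure\<close>

text \<open>Multiplication by a non-zero \<open>x\<close> permutes the non-zero elements; comparing
  the products over them gives \<open>x ^ (CARD('a) - 1) = 1\<close>.\<close>

lemma field_power_card_eq_same:
  fixes x :: "'a::{field,finite}"
  shows "x ^ CARD('a) = x"
proof (cases "x = 0")
  case False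
  have "(\<Prod>y\<in>UNIV-{0}. x * y) = \<Prod>(UNIV-{0})"
    by (rule prod.reindex_bij_witness[of _ "\<lambda>y. y / x" "\<lambda>y. x * y"]) (use False in auto)
  then have "x ^ (CARD('a) - 1) * \<Prod>(UNIV-{0::'a}) = \<Prod>(UNIV-{0})"
    by (simp add: prod.distrib)
  then have "x ^ (CARD('a) - 1) = 1"
    by simp
  moreover have "x ^ CARD('a) = x * x ^ (CARD('a) - 1)"
    by (metis power_eq_if zero_less_card_finite less_numeral_extra(3))
  ultimately show ?thesis
    by simp
qed (simp add: power_0_left)

text \<open>As Q = 0 in the field, X^Q - X has derivative -1, hence no repeated root, and it splits
  into Q distinct linear factors. This gives the sizes of L and E later.\<close>

lemma card_fixed_points_power:
  fixes Q :: nat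
  assumes Q: "Q > 1" "of_nat Q = (0 :: 'f::alg_closed_field)"
  shows "card {x :: 'f. x ^ Q = x} = Q"
proof -
  define p :: "'f poly" where "p = Polynomial.monom 1 Q + [:0, -1:]"
  have poly_p: "poly p x = x ^ Q - x" for x
    by (simp add: p_def poly_monom)
  have deg: "Polynomial.degree p = Q"
    unfolding p_def using Q(1) by (subst degree_add_eq_left) (auto simp: degree_monom_eq)
  then have p0: "p \<noteq> 0"
    using Q(1) by auto
  have dp: "pderiv p = [:-1:]"
    using Q(2) by (simp add: p_def pderiv_add pderiv_monom pderiv_pCons)
  obtain A where A: "size A = Polynomial.degree p" "p = Polynomial.smult (Polynomial.lead_coeff p) (\<Prod>x\<in>#A. [:-x, 1:])"
    using alg_closed_imp_factorization[OF p0] by blast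
  \<comment> \<open>A root occurring twice in the factorization would also be a root of the
    derivative, which is the constant -1.\<close>
  have "count A a \<le> 1" for a
  proof (rule ccontr)
    assume "\<not> ?thesis"
    then obtain B where B: "A = add_mset a (add_mset a B)"
      by (metis One_nat_def count_add_mset count_eq_zero_iff insert_DiffM less_one not_le nat_less_le Suc_leI le_zero_eq multi_member_split)
    have "p = [:-a, 1:] * ([:-a, 1:] * Polynomial.smult (Polynomial.lead_coeff p) (\<Prod>x\<in>#B. [:-x, 1:]))"
      by (subst A(2)) (simp add: B)
    then obtain g where g: "p = [:-a, 1:] * ([:-a, 1:] * g)" ..
    have "poly (pderiv p) a = 0"
      unfolding g by (simp only: pderiv_mult poly_add poly_mult) simp
    then show False
      by (simp add: dp)
  qed
  then have "A = mset_set (set_mset A)"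
    by (intro multiset_eqI) (metis count_eq_zero_iff count_mset_set finite_set_mset le_antisym less_one not_le)
  then have "card (set_mset A) = Q"
    using A(1) deg by (metis size_mset_set)
  moreover have "poly p x = 0 \<longleftrightarrow> x \<in># A" for x
    by (subst A(2)) (use p0 in \<open>auto simp: poly_prod_mset prod_mset_zero_iff\<close>)
  then have "{x. x ^ Q = x} = set_mset A"
    by (simp add: set_eq_iff poly_p)
  ultimately show ?thesis
    by simp
qed

section \<open>The space of block matrices\<close>

lemma mat_eqI_mult_vec:
  fixes A B :: "'a::semiring_1 mat"
  assumes "A \<in> carrier_mat m n" "B \<in> carrier_mat m n"
    and eq: "\<And>v. v \<in> carrier_vec n \<Longrightarrow> A *\<^sub>v v = B *\<^sub>v v"
  shows "A = B"
proof (rule eq_matI)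
  fix i j assume ij: "i < dim_row B" "j < dim_col B"
  have "(A *\<^sub>v unit_vec n j) $ i = (B *\<^sub>v unit_vec n j) $ i"
    using eq by simp
  then show "A $$ (i, j) = B $$ (i, j)"
    using assms(1,2) ij by simp
qed (use assms in auto)

lemma smult_mat_mult_vec:
  fixes A :: "'a::comm_ring_1 mat"
  assumes "A \<in> carrier_mat m n" "v \<in> carrier_vec n"
  shows "(a \<cdot>\<^sub>m A) *\<^sub>v v = a \<cdot>\<^sub>v (A *\<^sub>v v)"
  using assms by (intro eq_vecI) (auto simp: scalar_prod_def sum_distrib_left mult.assoc)

text \<open>Collects what the construction needs of F_q (embedded by \<open>\<iota>\<close>), L and
  E, taken as subsets of one field because their sizes depend on \<open>m\<close>. \<open>cj\<close>
  stands for the conjugation of E over L; it enters as an additive, F_q-homogeneous map on E with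
  trivial kernel whose norms \<open>u * cj u\<close> lie in L.\<close>

locale quadratic_extension =
  fixes \<iota> :: "'a::{field,finite} \<Rightarrow> 'f::field"
    and E L :: "'f set" and cj :: "'f \<Rightarrow> 'f" and y :: 'f and m :: nat
  assumes iota: "\<iota> 0 = 0" "\<iota> 1 = 1" "\<And>a b. \<iota> (a + b) = \<iota> a + \<iota> b"
      "\<And>a b. \<iota> (a * b) = \<iota> a * \<iota> b" "\<And>a. \<iota> a \<in> L"
    and E_add: "\<And>u v. u \<in> E \<Longrightarrow> v \<in> E \<Longrightarrow> u + v \<in> E"
    and E_mult: "\<And>u v. u \<in> E \<Longrightarrow> v \<in> E \<Longrightarrow> u * v \<in> E"
    and L_add: "\<And>u v. u \<in> L \<Longrightarrow> v \<in> L \<Longrightarrow> u + v \<in> L"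
    and L_mult: "\<And>u v. u \<in> L \<Longrightarrow> v \<in> L \<Longrightarrow> u * v \<in> L"
    and L_inverse: "\<And>u. u \<in> L \<Longrightarrow> inverse u \<in> L"
    and L_subset_E: "L \<subseteq> E"
    and y: "y \<in> E" "y \<notin> L"
    and cj_closed: "\<And>u. u \<in> E \<Longrightarrow> cj u \<in> E"
    and cj_add: "\<And>u v. u \<in> E \<Longrightarrow> v \<in> E \<Longrightarrow> cj (u + v) = cj u + cj v"
    and cj_scale: "\<And>a u. u \<in> E \<Longrightarrow> cj (\<iota> a * u) = \<iota> a * cj u"
    and norm_closed: "\<And>u. u \<in> E \<Longrightarrow> u * cj u \<in> L"
    and cj_eq_0: "\<And>u. u \<in> E \<Longrightarrow> cj u = 0 \<Longrightarrow> u = 0"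
    and card_E: "card E = CARD('a) ^ (2 * m)"
    and card_L: "card L = CARD('a) ^ m"
begin

lemma L_E: "u \<in> L \<Longrightarrow> u \<in> E"
  using L_subset_E by auto

lemma zero_L: "0 \<in> L" and one_L: "1 \<in> L"
  using iota(5)[of 0] iota(5)[of 1] iota(1,2) by simp_all

lemma iota_uminus: "\<iota> (- a) = - \<iota> a"
  using iota(3)[of a "- a"] iota(1) by (simp add: eq_neg_iff_add_eq_0 add.commute)

lemma L_uminus: "u \<in> L \<Longrightarrow> - u \<in> L"
  using L_mult[OF iota(5)[of "- 1"], of u] iota(2) iota_uminus[of 1] by simp

lemma E_uminus: "u \<in> E \<Longrightarrow> - u \<in> E"
  using E_mult[OF L_E[OF iota(5)[of "- 1"]], of u] iota(2) iota_uminus[of 1] by simp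

lemma L_diff: "u \<in> L \<Longrightarrow> v \<in> L \<Longrightarrow> u - v \<in> L"
  using L_add[of u "- v"] L_uminus[of v] by simp

lemmas closed = E_add E_mult L_add L_mult L_diff L_inverse L_E iota(5) zero_L one_L cj_closed y(1)

lemma cj_0: "cj 0 = 0"
  using cj_scale[of 0 0] iota(1) L_E[OF zero_L] by simp

section \<open>The F_q-space E^2 and the block operators on it\<close>

definition plane :: "('a, 'f \<times> 'f) module" where
  "plane = \<lparr>carrier = E \<times> E, monoid.mult = undefined, one = undefined, zero = (0, 0),
    add = (\<lambda>u v. (fst u + fst v, snd u + snd v)), module.smult = (\<lambda>a u. (\<iota> a * fst u, \<iota> a * snd u))\<rparr>"

lemma vectorspace_plane: "vectorspace class_ring plane"
proof (rule vs_criteria)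
  show "\<forall>v\<in>carrier plane. \<exists>w\<in>carrier plane. v \<oplus>\<^bsub>plane\<^esub> w = \<zero>\<^bsub>plane\<^esub>"
    by (auto simp: plane_def E_uminus intro!: bexI[of _ "- _"])
qed (auto simp: plane_def class_field closed iota algebra_simps)

text \<open>Linear over E in \<open>u\<close>, but additive and F_q-homogeneous in
  \<open>(x, c, d)\<close> because \<open>cj\<close> is so on E; hence the family of operators is
  closed under addition and F_q-scaling.\<close>

definition block :: "'f \<Rightarrow> 'f \<Rightarrow> 'f \<Rightarrow> 'f \<times> 'f \<Rightarrow> 'f \<times> 'f" where
  "block x c d u = (x * fst u + (c * y + d) * snd u, c * fst u + cj x * snd u)"

lemma block_closed:
  assumes "x \<in> E" "c \<in> L" "d \<in> L" "u \<in> E \<times> E"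
  shows "block x c d u \<in> E \<times> E"
  using assms by (auto simp: block_def closed)

text \<open>A non-zero kernel vector forces the determinant over E to vanish. If \<open>c\<close>
  were non-zero, this equation would express \<open>y\<close> through elements of L; so
  \<open>c = 0\<close>, and the vanishing norm of \<open>x\<close> forces
  \<open>x = 0\<close>.\<close>

lemma block_kernel:
  assumes "x \<in> E" "c \<in> L" "d \<in> L" "u \<noteq> (0, 0)" "block x c d u = (0, 0)"
  shows "x = 0 \<and> c = 0"
proof -
  obtain s t where u: "u = (s, t)"
    by (cases u)
  have eqs: "x * s + (c * y + d) * t = 0" "c * s + cj x * t = 0"
    using assms(5) by (simp_all add: block_def u)
  \<comment> \<open>Multiplication by the adjugate: the determinant times each coordinate of
    \<open>u\<close> is a combination of the two equations.\<close>
  have "(x * cj x - c * (c * y + d)) * s = cj x * (x * s + (c * y + d) * t) - (c * y + d) * (c * s + cj x * t)"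
    "(x * cj x - c * (c * y + d)) * t = x * (c * s + cj x * t) - c * (x * s + (c * y + d) * t)"
    by (simp_all add: algebra_simps)
  with eqs assms(4) have det: "x * cj x - c * (c * y + d) = 0"
    by (auto simp: u)
  have "c = 0"
  proof (rule ccontr)
    assume "c \<noteq> 0"
    with det have "y = (x * cj x - c * d) * inverse (c * c)"
      by (simp add: field_simps)
    also have "\<dots> \<in> L"
      using assms norm_closed closed by auto
    finally show False
      using y(2) by simp
  qed
  with det have "x * cj x = 0"
    by simp
  with \<open>c = 0\<close> show ?thesis
    using cj_eq_0 assms(1) by auto
qed

text \<open>Coordinates \<open>f\<close> on E^2 turn the block operators into matrices over F_q.
  Their determinant over F_q is tested only through the kernel, where \<open>block_kernel\<close>
  applies.\<close>

lemma ex_matrix_space: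
  "\<exists>M :: 'a mat set. is_subspace_of_dim (4 * m) (4 * m) M \<and>
    is_subspace_of_dim (4 * m) m {A \<in> M. det A = 0} \<and>
    (\<forall>A \<in> {A \<in> M. det A = 0}. A \<noteq> 0\<^sub>m (4 * m) (4 * m) \<longrightarrow>
       vec_space.rank (4 * m) A = 2 * m \<and> nilpotent_mat (4 * m) A)"
proof -
  define N where "N = 4 * m"
  have fin: "finite E"
    using card_E by (intro card_ge_0_finite) simp
  have "card (carrier plane) = CARD('a) ^ N"
    by (simp add: plane_def card_cartesian_product card_E N_def flip: power_add)
  then obtain f where f: "bij_betw f (carrier_vec N) (E \<times> E)"
    "\<And>v w. v \<in> carrier_vec N \<Longrightarrow> w \<in> carrier_vec N \<Longrightarrow>
      f (v + w) = (fst (f v) + fst (f w), snd (f v) + snd (f w))"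
    "\<And>a v. v \<in> carrier_vec N \<Longrightarrow> f (a \<cdot>\<^sub>v v) = (\<iota> a * fst (f v), \<iota> a * snd (f v))"
    using vectorspace_coordinates[OF vectorspace_plane, of N] fin by (auto simp: plane_def)
  have f_closed: "f v \<in> E \<times> E" if "v \<in> carrier_vec N" for v
    using f(1) that by (rule bij_betw_apply)
  have f_inj: "v = w" if "v \<in> carrier_vec N" "w \<in> carrier_vec N" "f v = f w" for v w
    using f(1) that by (meson bij_betw_imp_inj_on inj_onD)
  have f_surj: "\<exists>v\<in>carrier_vec N. f v = u" if "u \<in> E \<times> E" for u
    using f(1) that by (metis bij_betw_imp_surj_on imageE)
  have f_0: "f (0\<^sub>v N) = (0, 0)"
  proof -
    have "0 \<cdot>\<^sub>v 0\<^sub>v N = (0\<^sub>v N :: 'a vec)"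
      by (intro eq_vecI) auto
    then show ?thesis
      using f(3)[of "0\<^sub>v N" 0] by (simp add: iota(1))
  qed
  have zero_mult: "0\<^sub>m N N *\<^sub>v v = (0\<^sub>v N :: 'a vec)" if "v \<in> carrier_vec N" for v
    using that by (intro eq_vecI) auto
  \<comment> \<open>\<open>A\<close> represents the block operator in the coordinates
    \<open>f\<close>. Stated as a relation, it makes sums and scalar multiples of matrices match
    those of the parameters directly.\<close>
  define rep where "rep A x c d \<longleftrightarrow> A \<in> carrier_mat N N \<and>
    (\<forall>v\<in>carrier_vec N. f (A *\<^sub>v v) = block x c d (f v))" for A x c d
  have ex_rep: "\<exists>A. rep A x c d" if xcd: "x \<in> E" "c \<in> L" "d \<in> L" for x c d
  proof -
    \<comment> \<open>The block operator conjugated by \<open>f\<close>; injectivity of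
      \<open>f\<close> reduces linearity of \<open>T\<close> to that of
      \<open>block\<close>.\<close>
    define T where "T v = inv_into (carrier_vec N) f (block x c d (f v))" for v
    have T: "T v \<in> carrier_vec N" "f (T v) = block x c d (f v)" if "v \<in> carrier_vec N" for v
    proof -
      have "block x c d (f v) \<in> f ` carrier_vec N"
        using f(1) block_closed[OF xcd f_closed[OF that]] by (simp add: bij_betw_def)
      then show "T v \<in> carrier_vec N" "f (T v) = block x c d (f v)"
        by (simp_all add: T_def inv_into_into f_inv_into_f)
    qed
    obtain A where "A \<in> carrier_mat N N" "\<And>v. v \<in> carrier_vec N \<Longrightarrow> A *\<^sub>v v = T v"
    proof (rule mat_of_linear_map[of N T])
      show "T (v + w) = T v + T w" if "v \<in> carrier_vec N" "w \<in> carrier_vec N" for v w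
        using that by (intro f_inj) (auto simp: T f(2) block_def algebra_simps)
      show "T (a \<cdot>\<^sub>v v) = a \<cdot>\<^sub>v T v" if "v \<in> carrier_vec N" for a v
        using that by (intro f_inj) (auto simp: T f(3) block_def algebra_simps)
    qed (use T in auto)
    with T show ?thesis
      unfolding rep_def by auto
  qed
  have rep_unique: "A = B" if "rep A x c d" "rep B x c d" for A B x c d
  proof (rule mat_eqI_mult_vec)
    show "A *\<^sub>v v = B *\<^sub>v v" if "v \<in> carrier_vec N" for v
      using \<open>rep A x c d\<close> \<open>rep B x c d\<close> that unfolding rep_def by (intro f_inj) auto
  qed (use that in \<open>auto simp: rep_def\<close>)
  have rep_params: "x = x' \<and> c = c' \<and> d = d'" if "rep A x c d" "rep A x' c' d'" for A x c d x' c' d'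
  proof -
    have "block x c d u = block x' c' d' u" if "u \<in> E \<times> E" for u
      using \<open>rep A x c d\<close> \<open>rep A x' c' d'\<close> f_surj[OF that] unfolding rep_def by metis
    \<comment> \<open>The image of (1, 0) reads off \<open>x\<close> and \<open>c\<close>; that of
      (0, 1) then determines \<open>d\<close>.\<close>
    from this[of "(1, 0)"] this[of "(0, 1)"] show ?thesis
      by (auto simp: block_def closed)
  qed
  have rep_add: "rep (A + B) (x + x') (c + c') (d + d')"
    if "rep A x c d" "rep B x' c' d'" "x \<in> E" "x' \<in> E" for A B x c d x' c' d'
    using that unfolding rep_def
    by (auto simp: add_mult_distrib_mat_vec[of _ N N] f(2) block_def cj_add algebra_simps)
  have rep_smult: "rep (a \<cdot>\<^sub>m A) (\<iota> a * x) (\<iota> a * c) (\<iota> a * d)" if "rep A x c d" "x \<in> E" for a A x c d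
    using that unfolding rep_def
    by (auto simp: smult_mat_mult_vec[of _ N N] f(3) block_def cj_scale distrib_left distrib_right mult.assoc)
  have rep_0: "rep (0\<^sub>m N N) 0 0 0"
    unfolding rep_def by (auto simp: zero_mult f_0 block_def cj_0)
  have rep_det: "det A = 0 \<longleftrightarrow> x = 0 \<and> c = 0"
    if r: "rep A x c d" and "x \<in> E" "c \<in> L" "d \<in> L" for A x c d
  proof
    have A: "A \<in> carrier_mat N N"
      using r by (simp add: rep_def)
    show "x = 0 \<and> c = 0" if "det A = 0"
    proof -
      obtain v where v: "v \<in> carrier_vec N" "v \<noteq> 0\<^sub>v N" "A *\<^sub>v v = 0\<^sub>v N"
        using det_0_iff_vec_prod_zero[OF A] \<open>det A = 0\<close> by auto
      have "f v \<noteq> (0, 0)"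
        using f_inj[of v "0\<^sub>v N"] v f_0 by auto
      moreover have "block x c d (f v) = (0, 0)"
        using r v f_0 unfolding rep_def by metis
      ultimately show ?thesis
        using block_kernel \<open>x \<in> E\<close> \<open>c \<in> L\<close> \<open>d \<in> L\<close> by blast
    qed
    show "det A = 0" if "x = 0 \<and> c = 0"
    proof -
      \<comment> \<open>With \<open>x = c = 0\<close> the operator sends (s, t) to (d t, 0), so (1,
        0) is a non-zero kernel vector.\<close>
      obtain v where v: "v \<in> carrier_vec N" "f v = (1, 0)"
        using f_surj[of "(1, 0)"] by (auto simp: closed)
      have "v \<noteq> 0\<^sub>v N"
        using v f_0 by auto
      moreover have "A *\<^sub>v v = 0\<^sub>v N"
        using r v A that f_0 unfolding rep_def by (intro f_inj) (auto simp: block_def)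
      ultimately show ?thesis
        using det_0_iff_vec_prod_zero[OF A] v(1) by blast
    qed
  qed
  define M where "M = {A. \<exists>x\<in>E. \<exists>c\<in>L. \<exists>d\<in>L. rep A x c d}"
  define S where "S = {A. \<exists>d\<in>L. rep A 0 0 d}"
  have S_eq: "{A \<in> M. det A = 0} = S"
    unfolding M_def S_def using rep_det L_E zero_L by blast
  \<comment> \<open>One representative per triple: counting M becomes counting E x L x L, of size
    q^(2m) q^m q^m, and counting S becomes counting the slice \<open>x = c = 0\<close>, of size
    q^m.\<close>
  define g where "g = (\<lambda>(x, c, d). SOME A. rep A x c d)"
  have g: "rep (g (x, c, d)) x c d" if "x \<in> E" "c \<in> L" "d \<in> L" for x c d
    using someI_ex[OF ex_rep[OF that]] by (simp add: g_def)
  have inj_g: "inj_on g (E \<times> L \<times> L)"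
    using g rep_params by (intro inj_onI) (metis (no_types, lifting) mem_Sigma_iff prod_cases3)
  have g_eq: "rep A x c d \<longleftrightarrow> A = g (x, c, d)" if "x \<in> E" "c \<in> L" "d \<in> L" for A x c d
    using g[OF that] rep_unique by blast
  have "M = g ` (E \<times> L \<times> L)"
    unfolding M_def by (auto simp: g_eq image_iff Bex_def)
  then have card_M: "card M = CARD('a) ^ N"
    using inj_g
    by (simp add: card_image card_cartesian_product card_E card_L N_def flip: power_add)
  have "S = g ` ({0} \<times> {0} \<times> L)"
    unfolding S_def by (auto simp: g_eq L_E[OF zero_L] zero_L)
  moreover have "inj_on g ({0} \<times> {0} \<times> L)"
    using inj_g L_E[OF zero_L] zero_L by (rule_tac inj_on_subset) auto
  ultimately have card_S: "card S = CARD('a) ^ m"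
    by (simp add: card_image card_cartesian_product card_L)
  have "is_subspace_of_dim N N M"
  proof (rule is_subspace_of_dimI)
    show "M \<subseteq> carrier_mat N N"
      by (auto simp: M_def rep_def)
    show "0\<^sub>m N N \<in> M"
      unfolding M_def using rep_0 zero_L L_E[OF zero_L] by blast
    show "A + B \<in> M" if "A \<in> M" "B \<in> M" for A B
      using that rep_add E_add L_add unfolding M_def by blast
    show "a \<cdot>\<^sub>m A \<in> M" if "A \<in> M" for a A
      using that rep_smult E_mult L_mult L_E iota(5) unfolding M_def by blast
  qed (fact card_M)
  moreover have "is_subspace_of_dim N m S"
  proof (rule is_subspace_of_dimI)
    show "S \<subseteq> carrier_mat N N"
      by (auto simp: S_def rep_def)
    show "0\<^sub>m N N \<in> S"
      unfolding S_def using rep_0 zero_L L_E[OF zero_L] by blast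
    show "A + B \<in> S" if "A \<in> S" "B \<in> S" for A B
    proof -
      obtain d d' where "d \<in> L" "d' \<in> L" "rep A 0 0 d" "rep B 0 0 d'"
        using \<open>A \<in> S\<close> \<open>B \<in> S\<close> unfolding S_def by blast
      then show ?thesis
        using rep_add[of A 0 0 d B 0 0 d'] L_add L_E[OF zero_L] by (auto simp: S_def)
    qed
    show "a \<cdot>\<^sub>m A \<in> S" if "A \<in> S" for a A
    proof -
      obtain d where "d \<in> L" "rep A 0 0 d"
        using \<open>A \<in> S\<close> unfolding S_def by blast
      then show ?thesis
        using rep_smult[of A 0 0 d a] L_mult iota(5) L_E[OF zero_L] by (auto simp: S_def)
    qed
  qed (fact card_S)
  moreover have "vec_space.rank N A = 2 * m \<and> nilpotent_mat N A" if "A \<in> S" "A \<noteq> 0\<^sub>m N N" for A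
  proof -
    obtain d where d: "d \<in> L" "rep A 0 0 d"
      using \<open>A \<in> S\<close> unfolding S_def by auto
    then have A: "A \<in> carrier_mat N N"
      by (simp add: rep_def)
    have "d \<noteq> 0"
      using d rep_0 rep_unique \<open>A \<noteq> 0\<^sub>m N N\<close> by blast
    have f_A: "f (A *\<^sub>v v) = (d * snd (f v), 0)" if "v \<in> carrier_vec N" for v
      using d(2) that by (simp add: rep_def block_def cj_0)
    \<comment> \<open>The image of \<open>A\<close> corresponds to the whole first axis:
      \<open>d\<close> is invertible in L, so d t runs through E as t does. Its q^(2m) elements give
      the rank.\<close>
    have "f ` (\<lambda>v. A *\<^sub>v v) ` carrier_vec N = E \<times> {0}"
    proof (intro equalityI subsetI)
      show "u \<in> E \<times> {0}" if "u \<in> f ` (\<lambda>v. A *\<^sub>v v) ` carrier_vec N" for u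
        using that f_A f_closed d(1) closed by fastforce
      show "u \<in> f ` (\<lambda>v. A *\<^sub>v v) ` carrier_vec N" if "u \<in> E \<times> {0}" for u
      proof -
        obtain s where s: "u = (s, 0)" "s \<in> E"
          using \<open>u \<in> E \<times> {0}\<close> by auto
        then obtain v where "v \<in> carrier_vec N" "f v = (0, inverse d * s)"
          using f_surj[of "(0, inverse d * s)"] d(1) closed by auto
        then have "v \<in> carrier_vec N" "f (A *\<^sub>v v) = u"
          using f_A s \<open>d \<noteq> 0\<close> by auto
        then show ?thesis
          by blast
      qed
    qed
    moreover have "inj_on f ((\<lambda>v. A *\<^sub>v v) ` carrier_vec N)"
      using A f_inj by (auto intro!: inj_onI)
    ultimately have "card ((\<lambda>v. A *\<^sub>v v) ` carrier_vec N) = card (E \<times> {0::'f})"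
      using card_image by fastforce
    also have "\<dots> = CARD('a) ^ (2 * m)"
      by (simp add: card_cartesian_product card_E)
    finally have "card ((\<lambda>v. A *\<^sub>v v) ` carrier_vec N) = CARD('a) ^ (2 * m)" .
    then have "vec_space.rank N A = 2 * m"
      using rank_eqI_card[OF A] by blast
    \<comment> \<open>By \<open>f_A\<close>, values of \<open>A\<close> have second coordinate 0,
      and \<open>A\<close> kills all such vectors.\<close>
    moreover have "A * A = 0\<^sub>m N N"
    proof (rule mat_eqI_mult_vec)
      show "(A * A) *\<^sub>v v = 0\<^sub>m N N *\<^sub>v v" if "v \<in> carrier_vec N" for v
        using A that f_A f_0 by (intro f_inj) (auto simp: zero_mult assoc_mult_mat_vec[of _ N N _ N])
    qed (use A in auto)
    then have "A ^\<^sub>m 2 = 0\<^sub>m N N"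
      using A by (simp add: numeral_2_eq_2)
    ultimately show ?thesis
      unfolding nilpotent_mat_def by blast
  qed
  ultimately show ?thesis
    unfolding N_def[symmetric] by (intro exI[of _ M]) (simp add: S_eq)
qed

end

section \<open>Realising the fields L and E inside the algebraic closure of F_q\<close>

theorem corollary9:
  fixes q m :: nat
  assumes "\<exists>k>0. q = 2 ^ k"
    and "CARD('a::{field,finite}) = q"
    and "m > 0"
  shows "\<exists>M :: 'a mat set.
    is_subspace_of_dim (4 * m) (4 * m) M \<and>
    is_subspace_of_dim (4 * m) m {A \<in> M. det A = 0} \<and>
    (\<forall>A \<in> {A \<in> M. det A = 0}. A \<noteq> 0\<^sub>m (4 * m) (4 * m) \<longrightarrow>
       vec_space.rank (4 * m) A = 2 * m \<and> nilpotent_mat (4 * m) A)"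
proof -
  obtain k where k: "k > 0" "q = 2 ^ k"
    using assms(1) by blast
  \<comment> \<open>The characteristic is a prime dividing the order 2^k of the field, hence
    2.\<close>
  have "prime CHAR('a)"
    by (rule prime_CHAR_semidom) (simp add: finite_imp_CHAR_pos)
  moreover have "CHAR('a) dvd 2 ^ k"
    using CHAR_dvd_CARD[where ?'a = 'a] assms(2) k(2) by simp
  ultimately have char: "CHAR('a) = 2"
    by (metis prime_dvd_power primes_dvd_imp_eq two_is_prime_nat)
  define r where "r = q ^ m"
  have r: "r = 2 ^ (k * m)" "r > 1"
    using k assms(3) by (simp_all add: r_def power_mult one_less_power del: One_nat_def)
  have r_0: "of_nat r = (0 :: 'a alg_closure)"
    unfolding of_nat_eq_0_iff_char_dvd CHAR_alg_closure char r(1) using k assms(3) by simp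
  \<comment> \<open>\<open>r\<close> is a power of the characteristic, so the r-th power map is
    additive.\<close>
  have frob_add: "(u + v) ^ r = u ^ r + v ^ r" for u v :: "'a alg_closure"
    by (rule freshmans_dream'[where n = "k * m"]) (simp_all add: char r(1))
  have iota_r: "to_ac a ^ r = to_ac a" for a :: 'a
  proof -
    \<comment> \<open>Iterating a^q = a shows that F_q is fixed by the r-th power map, which places
      it inside L.\<close>
    have "a ^ (q ^ j) = a" for j
      by (induction j) (simp_all add: power_mult field_power_card_eq_same flip: assms(2))
    then show ?thesis
      by (simp add: r_def flip: to_ac_power)
  qed
  \<comment> \<open>The fixed points of two powers of Frobenius, that is, the subfields with q^(2m)
    and q^m elements.\<close>
  define E L :: "'a alg_closure set" where "E = {x. x ^ (r * r) = x}" and "L = {x. x ^ r = x}"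
  have card_E: "card E = r * r"
    unfolding E_def
    by (rule card_fixed_points_power[OF less_1_mult[OF r(2) r(2)]]) (simp add: r_0)
  have card_L: "card L = r"
    unfolding L_def using r(2) r_0 by (intro card_fixed_points_power)
  \<comment> \<open>Otherwise r^2 would be at most r, contrary to r > 1.\<close>
  have "\<not> E \<subseteq> L"
    using card_mono[of L E] card_ge_0_finite[of L] card_L card_E r(2) by auto
  then obtain y where y: "y \<in> E" "y \<notin> L"
    by blast
  \<comment> \<open>Conjugation is the r-th power map. On E the power u^(r^2) equals u, so the r-th
    power of u u^r is u^r u, and norms lie in L.\<close>
  interpret quadratic_extension to_ac E L "\<lambda>x. x ^ r" y m
  proof
    show "card E = CARD('a) ^ (2 * m)" "card L = CARD('a) ^ m"
      using card_E card_L assms(2) by (simp_all add: r_def mult_2 power_add)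
  qed (use y r(2) in \<open>auto simp: E_def L_def iota_r frob_add power_mult power_mult_distrib power_inverse\<close>)
  show ?thesis
    by (rule ex_matrix_space)
qed

end
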